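(* Let $(J_1,J_2)$ be a breaker pair of interval summands of $V[p,q]$, where $V[p,q]$ is the restriction to $[p,q]$ (with $1\le p\le q\le n$) of a finite-dimensional zigzag module $V$ of length $n$ over a field $K$, and let $J_1\cong I[b_1,d_1]$, $J_2\cong I[b_2,d_2]$. Then $J_1\oplus J_2$, restricted to $[b_1,d_2]$, contains a nonsplitting submodule isomorphic to $I[b_1,d_2]$. Moreover, $J_1\oplus J_2$ has no direct summand isomorphic to $I[b_1,d_2]$.
   Context: Let $K$ be a field. A zigzag module $V$ of length $n$ over $K$ consists of finite-dimensional $K$-vector spaces $V_1,\dots,V_n$ together with, for each $1\le i<n$, exactly one linear map, either $V_i\to V_{i+1}$ (a forward arrow) or $V_i\leftarrow V_{i+1}$ (a backward arrow). The sequence of arrow directions is the zigzag type; it is fixed and all modules compared have the same type. For $p\le q$, the restriction to $[p,q]$ keeps only the vector spaces and arrows with indices between $p$ and $q$. Intervals $[b,d]$ are discrete (sets of integers). The interval module $I[b,d]$ (support $[b,d]$) has $I[b,d]_i=K$ for $b\le i\le d$ and $0$ otherwise, with identity maps between consecutive nonzero spaces and zero maps otherwise. An interval decomposition of $V[p,q]$ is a finite direct sum decomposition into submodules (the interval summands) each isomorphic to an interval module $I[b,d]$ with $p\le b\le d\le q$. A submodule is a family of subspaces preserved by all structure maps; it is a direct summand if it has a complementary submodule. A submodule is nonsplitting if it is not a direct summand. Breaker pair: an ordered pair $(J_1,J_2)$ of interval summands with $J_1\cong I[b_1,d_1]$, $J_2\cong I[b_2,d_2]$ is a breaker pair if $b_1<b_2\le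 d_1<d_2$, the arrow between $b_2-1$ and $b_2$ is backward, $V_{b_2-1}\leftarrow V_{b_2}$, and the arrow between $d_1$ and $d_1+1$ is forward, $V_{d_1}\to V_{d_1+1}$. *)

theory Defs
  imports "Jordan_Normal_Form.Missing_VectorSpace" "HOL-Algebra.AbelCoset"
begin

text \<open>
  Zigzag modules are indexed by the integer interval from \<open>lo\<close> to \<open>hi\<close>. The arrow with number \<open>i\<close>
  joins the spaces with indices \<open>i\<close> and \<open>Suc i\<close>, and \<open>dir\<close> records the zigzag type. Values of the
  fields outside the index range carry no meaning; every notion below ignores them.
\<close>

datatype direction = Forward | Backward

record ('k, 'v) zigzag =
  lo :: nat
  hi :: nat
  dir :: "nat \<Rightarrow> direction"
  space :: "nat \<Rightarrow> ('k, 'v) module"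
  arrow :: "nat \<Rightarrow> 'v \<Rightarrow> 'v"

definition src :: "('k, 'v) zigzag \<Rightarrow> nat \<Rightarrow> nat" where
  "src X i = (case dir X i of Forward \<Rightarrow> i | Backward \<Rightarrow> Suc i)"

definition tgt :: "('k, 'v) zigzag \<Rightarrow> nat \<Rightarrow> nat" where
  "tgt X i = (case dir X i of Forward \<Rightarrow> Suc i | Backward \<Rightarrow> i)"

definition zigzag_module :: "('k, 'r) ring_scheme \<Rightarrow> ('k, 'v) zigzag \<Rightarrow> bool" where
  "zigzag_module K X \<longleftrightarrow>
     (\<forall>i\<in>{lo X..hi X}. vectorspace K (space X i) \<and> vectorspace.fin_dim K (space X i)) \<and>
     (\<forall>i\<in>{lo X..<hi X}. linear_map K (space X (src X i)) (space X (tgt X i)) (arrow X i))"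

definition restriction :: "('k, 'v) zigzag \<Rightarrow> nat \<Rightarrow> nat \<Rightarrow> ('k, 'v) zigzag" where
  "restriction X p q = X\<lparr>lo := p, hi := q\<rparr>"

definition zigzag_iso ::
    "('k, 'r) ring_scheme \<Rightarrow> ('k, 'v) zigzag \<Rightarrow> ('k, 'w) zigzag \<Rightarrow> bool" where
  "zigzag_iso K X Y \<longleftrightarrow>
     lo X = lo Y \<and> hi X = hi Y \<and> (\<forall>i\<in>{lo X..<hi X}. dir X i = dir Y i) \<and>
     (\<exists>\<phi>. (\<forall>i\<in>{lo X..hi X}. linear_map K (space X i) (space Y i) (\<phi> i) \<and>
                bij_betw (\<phi> i) (carrier (space X i)) (carrier (space Y i))) \<and>
          (\<forall>i\<in>{lo X..<hi X}. \<forall>v\<in>carrier (space X (src X i)).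
                \<phi> (tgt X i) (arrow X i v) = arrow Y i (\<phi> (src X i) v)))"

text \<open>
  With \<open>S = carrier K\<close> this is the field as a vector space over itself, and with
  \<open>S = {\<zero>\<^bsub>K\<^esub>}\<close> the zero space.
\<close>

definition scalars_on :: "('k, 'r) ring_scheme \<Rightarrow> 'k set \<Rightarrow> ('k, 'k) module" where
  "scalars_on K S = \<lparr>carrier = S, mult = mult K, one = one K, zero = zero K, add = add K,
     smult = mult K\<rparr>"

text \<open>The interval module \<open>I[b,d]\<close> of type \<open>\<tau>\<close> over the index range from \<open>l\<close> to \<open>h\<close>.\<close>

definition interval_module ::
    "('k, 'r) ring_scheme \<Rightarrow> nat \<Rightarrow> nat \<Rightarrow> (nat \<Rightarrow> direction) \<Rightarrow> nat \<Rightarrow> nat \<Rightarrow> ('k, 'k) zigzag" where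
  "interval_module K l h \<tau> b d =
     \<lparr>lo = l, hi = h, dir = \<tau>,
      space = (\<lambda>i. scalars_on K (if b \<le> i \<and> i \<le> d then carrier K else {\<zero>\<^bsub>K\<^esub>})),
      arrow = (\<lambda>i v. if b \<le> i \<and> Suc i \<le> d then v else \<zero>\<^bsub>K\<^esub>)\<rparr>"

definition is_interval ::
    "('k, 'r) ring_scheme \<Rightarrow> ('k, 'v) zigzag \<Rightarrow> nat \<Rightarrow> nat \<Rightarrow> bool" where
  "is_interval K X b d \<longleftrightarrow> lo X \<le> b \<and> b \<le> d \<and> d \<le> hi X \<and>
     zigzag_iso K X (interval_module K (lo X) (hi X) (dir X) b d)"

definition zigzag_submodule ::
    "('k, 'r) ring_scheme \<Rightarrow> ('k, 'v) zigzag \<Rightarrow> (nat \<Rightarrow> 'v set) \<Rightarrow> bool" where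
  "zigzag_submodule K X W \<longleftrightarrow>
     (\<forall>i\<in>{lo X..hi X}. VectorSpace.subspace K (W i) (space X i)) \<and>
     (\<forall>i\<in>{lo X..<hi X}. arrow X i ` W (src X i) \<subseteq> W (tgt X i))"

definition as_zigzag :: "('k, 'v) zigzag \<Rightarrow> (nat \<Rightarrow> 'v set) \<Rightarrow> ('k, 'v) zigzag" where
  "as_zigzag X W = X\<lparr>space := (\<lambda>i. (space X i)\<lparr>carrier := W i\<rparr>)\<rparr>"

definition sub_sum ::
    "('k, 'v) zigzag \<Rightarrow> (nat \<Rightarrow> 'v set) \<Rightarrow> (nat \<Rightarrow> 'v set) \<Rightarrow> nat \<Rightarrow> 'v set" where
  "sub_sum X W U = (\<lambda>i. set_add (space X i) (W i) (U i))"

definition direct_summand ::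
    "('k, 'r) ring_scheme \<Rightarrow> ('k, 'v) zigzag \<Rightarrow> (nat \<Rightarrow> 'v set) \<Rightarrow> bool" where
  "direct_summand K X W \<longleftrightarrow> zigzag_submodule K X W \<and>
     (\<exists>U. zigzag_submodule K X U \<and>
        (\<forall>i\<in>{lo X..hi X}. W i \<inter> U i = {\<zero>\<^bsub>space X i\<^esub>} \<and> sub_sum X W U i = carrier (space X i)))"

definition nonsplitting ::
    "('k, 'r) ring_scheme \<Rightarrow> ('k, 'v) zigzag \<Rightarrow> (nat \<Rightarrow> 'v set) \<Rightarrow> bool" where
  "nonsplitting K X W \<longleftrightarrow> zigzag_submodule K X W \<and> \<not> direct_summand K X W"

text \<open>
  The members of \<open>Js\<close> are the interval summands. The sum being direct is expressed by unique
  decomposition of every vector of every space.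
\<close>

definition interval_decomposition ::
    "('k, 'r) ring_scheme \<Rightarrow> ('k, 'v) zigzag \<Rightarrow> (nat \<Rightarrow> 'v set) list \<Rightarrow> bool" where
  "interval_decomposition K X Js \<longleftrightarrow>
     (\<forall>J\<in>set Js. zigzag_submodule K X J \<and> (\<exists>b d. is_interval K (as_zigzag X J) b d)) \<and>
     (\<forall>i\<in>{lo X..hi X}. \<forall>v\<in>carrier (space X i).
        \<exists>!x. x \<in> (\<Pi>\<^sub>E k\<in>{..<length Js}. (Js ! k) i) \<and>
             (\<Oplus>\<^bsub>space X i\<^esub>k\<in>{..<length Js}. x k) = v)"

definition breaker_pair ::
    "('k, 'r) ring_scheme \<Rightarrow> ('k, 'v) zigzag \<Rightarrow> (nat \<Rightarrow> 'v set) \<Rightarrow> (nat \<Rightarrow> 'v set) \<Rightarrow>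
     nat \<Rightarrow> nat \<Rightarrow> nat \<Rightarrow> nat \<Rightarrow> bool" where
  "breaker_pair K X J1 J2 b1 d1 b2 d2 \<longleftrightarrow>
     is_interval K (as_zigzag X J1) b1 d1 \<and> is_interval K (as_zigzag X J2) b2 d2 \<and>
     b1 < b2 \<and> b2 \<le> d1 \<and> d1 < d2 \<and>
     dir X (b2 - 1) = Backward \<and> dir X d1 = Forward"

end

theory Submission
  imports Defs
begin

text \<open>
  Let \<open>e\<close> and \<open>f\<close> be generators of \<open>J1\<close> and \<open>J2\<close> that are compatible with the arrows and vanish
  outside the supports. The vectors \<open>e i + f i\<close> span a copy of \<open>I[b1,d2]\<close>: the only arrows that
  could fail to respect them enter \<open>[b2,d2]\<close> from the left or \<open>[b1,d1]\<close> from the right, and the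
  two direction conditions rule these out.

  No copy \<open>W\<close> of \<open>I[b1,d2]\<close> in \<open>J1 + J2\<close> has a complement \<open>U\<close>. Write its generator as
  \<open>w i = x i + y i\<close> with \<open>x i\<close> in \<open>J1\<close> and \<open>y i\<close> in \<open>J2\<close>. Then \<open>y b1 = 0\<close> lies in \<open>U\<close>; membership
  of \<open>y i\<close> in \<open>U\<close> propagates along the arrows in both directions, because the arrows are injective
  on \<open>W\<close>. Hence \<open>y d2 = w d2\<close> lies in the intersection of \<open>W\<close> and \<open>U\<close>, although it is nonzero.
\<close>

section \<open>Subspaces\<close>

text \<open>The two sets allowed for \<open>S\<close> are the carriers occurring in
  \<open>interval_module\<close>. This makes its spaces valid codomains for linear maps.\<close>

lemma vectorspace_scalars_on:
  assumes "field K" and S: "S = carrier K \<or> S = {\<zero>\<^bsub>K\<^esub>}"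
  shows "vectorspace K (scalars_on K S)"
proof -
  interpret field K by fact
  have "module K (scalars_on K S)"
    using S
    by (intro module.intro module_axioms.intro abelian_groupI is_cring)
      (auto simp: scalars_on_def a_ac l_distr r_distr m_assoc intro!: bexI[OF _ a_inv_closed] r_neg)
  then show ?thesis
    using assms(1) by (simp add: vectorspace_def)
qed

text \<open>If \<open>a - b\<close> were nonzero, it would be a unit annihilating \<open>v\<close>.
  Hence coordinates with respect to a nonzero generator are unique.\<close>

lemma (in vectorspace) smult_right_cancel:
  assumes "a \<in> carrier K" "b \<in> carrier K" "v \<in> carrier V" "v \<noteq> \<zero>\<^bsub>V\<^esub>"
    and "a \<odot>\<^bsub>V\<^esub> v = b \<odot>\<^bsub>V\<^esub> v"
  shows "a = b"
proof (rule ccontr)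
  assume "a \<noteq> b"
  define c where "c = a \<ominus>\<^bsub>K\<^esub> b"
  have c: "c \<in> carrier K" "c \<noteq> \<zero>\<^bsub>K\<^esub>"
    using assms \<open>a \<noteq> b\<close> by (auto simp: c_def)
  have "c \<odot>\<^bsub>V\<^esub> v = \<zero>\<^bsub>V\<^esub>"
    using assms by (simp add: c_def a_minus_def smult_l_distr smult_l_minus M.r_neg)
  then have "inv\<^bsub>K\<^esub> c \<odot>\<^bsub>V\<^esub> (c \<odot>\<^bsub>V\<^esub> v) = \<zero>\<^bsub>V\<^esub>"
    using c by (simp add: field_Units)
  moreover have "inv\<^bsub>K\<^esub> c \<odot>\<^bsub>V\<^esub> (c \<odot>\<^bsub>V\<^esub> v) = (inv\<^bsub>K\<^esub> c \<otimes>\<^bsub>K\<^esub> c) \<odot>\<^bsub>V\<^esub> v"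
    using c assms(3) by (subst smult_assoc1) (simp_all add: field_Units)
  moreover have "inv\<^bsub>K\<^esub> c \<otimes>\<^bsub>K\<^esub> c = \<one>\<^bsub>K\<^esub>"
    using c by (simp add: field_Units)
  ultimately show False
    using assms(3,4) by simp
qed

lemma subspaceD:
  assumes "subspace K W V"
  shows "vectorspace K V" "W \<subseteq> carrier V" "\<zero>\<^bsub>V\<^esub> \<in> W"
    and "\<And>u v. u \<in> W \<Longrightarrow> v \<in> W \<Longrightarrow> u \<oplus>\<^bsub>V\<^esub> v \<in> W"
    and "\<And>a v. a \<in> carrier K \<Longrightarrow> v \<in> W \<Longrightarrow> a \<odot>\<^bsub>V\<^esub> v \<in> W"
    and "\<And>u v. u \<in> W \<Longrightarrow> v \<in> W \<Longrightarrow> u \<ominus>\<^bsub>V\<^esub> v \<in> W"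
proof -
  interpret vectorspace K V using assms by (rule subspace.vs)
  interpret W: LinearCombinations.submodule K W V using assms by (rule subspace.submod)
  show "vectorspace K V" by unfold_locales
  show "W \<subseteq> carrier V" by (rule W.subset)
  show "\<zero>\<^bsub>V\<^esub> \<in> W" by simp
  show "u \<oplus>\<^bsub>V\<^esub> v \<in> W" if "u \<in> W" "v \<in> W" for u v using that by simp
  show "a \<odot>\<^bsub>V\<^esub> v \<in> W" if "a \<in> carrier K" "v \<in> W" for a v using that by simp
  show "u \<ominus>\<^bsub>V\<^esub> v \<in> W" if "u \<in> W" "v \<in> W" for u v
  proof -
    have "v \<in> carrier V" using that W.subset by auto
    then show ?thesis using that by (simp add: a_minus_def smult_minus_1_back)
  qed
qed

lemma subspace_carrier_update:
  assumes "subspace K W V" "subspace K S V" "W \<subseteq> S"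
  shows "subspace K W (V\<lparr>carrier := S\<rparr>)"
proof -
  interpret vectorspace K V using assms(1) by (rule subspace.vs)
  have vs: "vectorspace K (V\<lparr>carrier := S\<rparr>)" using assms(2) by (rule subspace_is_vs)
  show ?thesis
    by (intro subspace.intro submodule.intro vs vectorspace.axioms(1)[OF vs])
      (use assms(3) subspaceD[OF assms(1)] in simp_all)
qed

text \<open>The difference \<open>a - a'\<close> equals \<open>b' - b\<close> and so lies in
  \<open>A \<inter> B\<close>. Comparisons of components in \<open>J1 + J2\<close> and in
  \<open>W + U\<close> rest on this.\<close>

lemma sum_components_unique:
  assumes A: "subspace K A V" and B: "subspace K B V" and AB: "A \<inter> B = {\<zero>\<^bsub>V\<^esub>}"
    and a: "a \<in> A" "a' \<in> A" and b: "b \<in> B" "b' \<in> B"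
    and eq: "a \<oplus>\<^bsub>V\<^esub> b = a' \<oplus>\<^bsub>V\<^esub> b'"
  shows "a = a'" "b = b'"
proof -
  interpret vectorspace K V using A by (rule subspace.vs)
  have car: "a \<in> carrier V" "a' \<in> carrier V" "b \<in> carrier V" "b' \<in> carrier V"
    using a b subspaceD(2)[OF A] subspaceD(2)[OF B] by auto
  have "a = (a' \<oplus>\<^bsub>V\<^esub> b') \<ominus>\<^bsub>V\<^esub> b"
    unfolding eq[symmetric] using car by (simp add: a_minus_def M.a_assoc M.r_neg)
  also have "\<dots> = a' \<oplus>\<^bsub>V\<^esub> (b' \<ominus>\<^bsub>V\<^esub> b)"
    using car by (simp add: a_minus_def M.a_assoc)
  finally have a_eq: "a = a' \<oplus>\<^bsub>V\<^esub> (b' \<ominus>\<^bsub>V\<^esub> b)" .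
  have "a \<ominus>\<^bsub>V\<^esub> a' = \<ominus>\<^bsub>V\<^esub> a' \<oplus>\<^bsub>V\<^esub> a"
    using car by (simp add: a_minus_def M.a_comm)
  also have "\<dots> = \<ominus>\<^bsub>V\<^esub> a' \<oplus>\<^bsub>V\<^esub> (a' \<oplus>\<^bsub>V\<^esub> (b' \<ominus>\<^bsub>V\<^esub> b))"
    using a_eq by simp
  also have "\<dots> = b' \<ominus>\<^bsub>V\<^esub> b"
    using car by (simp add: M.r_neg1)
  finally have "a \<ominus>\<^bsub>V\<^esub> a' = b' \<ominus>\<^bsub>V\<^esub> b" .
  then have "a \<ominus>\<^bsub>V\<^esub> a' \<in> A \<inter> B"
    using subspaceD(6)[OF A a] subspaceD(6)[OF B b(2) b(1)] by simp
  then show "a = a'" using AB car by simp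
  then show "b = b'" using eq car by simp
qed

section \<open>Zigzag modules and submodules\<close>

lemma as_zigzag_simps [simp]:
  "lo (as_zigzag X W) = lo X" "hi (as_zigzag X W) = hi X" "dir (as_zigzag X W) = dir X"
  "arrow (as_zigzag X W) = arrow X" "space (as_zigzag X W) i = (space X i)\<lparr>carrier := W i\<rparr>"
  "src (as_zigzag X W) = src X" "tgt (as_zigzag X W) = tgt X"
  by (auto simp: as_zigzag_def src_def tgt_def)

lemma restriction_simps [simp]:
  "lo (restriction X p q) = p" "hi (restriction X p q) = q" "dir (restriction X p q) = dir X"
  "arrow (restriction X p q) = arrow X" "space (restriction X p q) = space X"
  "src (restriction X p q) = src X" "tgt (restriction X p q) = tgt X"
  by (auto simp: restriction_def src_def tgt_def)

lemma src_tgt_range: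
  assumes "i \<in> {l..<h}"
  shows "src X i \<in> {l..h}" "tgt X i \<in> {l..h}"
  using assms by (auto simp: src_def tgt_def split: direction.splits)

lemma zigzag_submodule_subset:
  assumes "zigzag_submodule K X W" "i \<in> {lo X..hi X}"
  shows "W i \<subseteq> carrier (space X i)"
proof -
  have "subspace K (W i) (space X i)" using assms by (auto simp: zigzag_submodule_def)
  then show ?thesis by (rule subspaceD(2))
qed

text \<open>This is the part of \<open>zigzag_module\<close> that passes directly to restrictions
  and to submodules with the induced operations, the two constructions that produce \<open>S\<close>
  and its restriction.\<close>

definition zigzag_linear :: "('k, 'r) ring_scheme \<Rightarrow> ('k, 'v) zigzag \<Rightarrow> bool" where
  "zigzag_linear K X \<longleftrightarrow>
     (\<forall>i\<in>{lo X..hi X}. vectorspace K (space X i)) \<and>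
     (\<forall>i\<in>{lo X..<hi X}. linear_map K (space X (src X i)) (space X (tgt X i)) (arrow X i))"

lemma zigzag_linear_restriction:
  assumes "zigzag_linear K X" "lo X \<le> p" "q \<le> hi X"
  shows "zigzag_linear K (restriction X p q)"
  using assms by (auto simp: zigzag_linear_def)

lemma zigzag_linear_as_zigzag:
  assumes X: "zigzag_linear K X" and W: "zigzag_submodule K X W"
  shows "zigzag_linear K (as_zigzag X W)"
proof -
  have vs: "vectorspace K ((space X i)\<lparr>carrier := W i\<rparr>)" if "i \<in> {lo X..hi X}" for i
    using that X W by (auto simp: zigzag_linear_def zigzag_submodule_def intro: vectorspace.subspace_is_vs)
  have "linear_map K ((space X (src X i))\<lparr>carrier := W (src X i)\<rparr>)
          ((space X (tgt X i))\<lparr>carrier := W (tgt X i)\<rparr>) (arrow X i)" if i: "i \<in> {lo X..<hi X}" for i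
  proof -
    interpret A: linear_map K "space X (src X i)" "space X (tgt X i)" "arrow X i"
      using X i by (auto simp: zigzag_linear_def)
    have "W (src X i) \<subseteq> carrier (space X (src X i))"
      using zigzag_submodule_subset[OF W src_tgt_range(1)[OF i, of X]] .
    moreover have "arrow X i ` W (src X i) \<subseteq> W (tgt X i)"
      using W i by (auto simp: zigzag_submodule_def)
    ultimately have "arrow X i \<in> module_hom K ((space X (src X i))\<lparr>carrier := W (src X i)\<rparr>)
          ((space X (tgt X i))\<lparr>carrier := W (tgt X i)\<rparr>)"
      by (auto simp: module_hom_def subset_iff)
    then show ?thesis
      using vs[OF src_tgt_range(1)[OF i, of X]] vs[OF src_tgt_range(2)[OF i, of X]]
      by (simp add: linear_map_def mod_hom_def mod_hom_axioms_def vectorspace.axioms(1))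
  qed
  with vs show ?thesis by (simp add: zigzag_linear_def)
qed

lemma zigzag_submodule_restriction:
  assumes "zigzag_submodule K X W" "lo X \<le> p" "q \<le> hi X"
  shows "zigzag_submodule K (restriction X p q) W"
  using assms by (auto simp: zigzag_submodule_def)

lemma zigzag_submodule_as_zigzag:
  assumes "zigzag_submodule K X W" "zigzag_submodule K X S"
    and "\<And>i. i \<in> {lo X..hi X} \<Longrightarrow> W i \<subseteq> S i"
  shows "zigzag_submodule K (as_zigzag X S) W"
  using assms(1,2) unfolding zigzag_submodule_def
  by (auto intro!: subspace_carrier_update assms(3)[THEN subsetD])

lemma sub_sum_iff: "v \<in> sub_sum X W U i \<longleftrightarrow> (\<exists>w\<in>W i. \<exists>u\<in>U i. v = w \<oplus>\<^bsub>space X i\<^esub> u)"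
  by (auto simp: sub_sum_def set_add_def')

text \<open>A sum of families depends only on the additions of the spaces, while
  \<open>as_zigzag\<close> changes only their carriers.\<close>

lemma sub_sum_as_zigzag [simp]: "sub_sum (as_zigzag X S) W U = sub_sum X W U"
  by (auto simp: sub_sum_def set_add_def')

lemma sub_sum_restriction [simp]: "sub_sum (restriction X p q) W U = sub_sum X W U"
  by (auto simp: sub_sum_def set_add_def')

lemma subset_sub_sum:
  assumes "zigzag_submodule K X W" "zigzag_submodule K X U" "i \<in> {lo X..hi X}"
  shows "W i \<subseteq> sub_sum X W U i" "U i \<subseteq> sub_sum X W U i"
proof -
  have W: "subspace K (W i) (space X i)" and U: "subspace K (U i) (space X i)"
    using assms by (auto simp: zigzag_submodule_def)
  interpret vectorspace K "space X i" using W by (rule subspace.vs)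
  show "W i \<subseteq> sub_sum X W U i"
    using subspaceD[OF W] subspaceD(3)[OF U] unfolding subset_iff sub_sum_iff
    by (metis M.r_zero)
  show "U i \<subseteq> sub_sum X W U i"
    using subspaceD[OF U] subspaceD(3)[OF W] unfolding subset_iff sub_sum_iff
    by (metis M.l_zero)
qed

lemma zigzag_submodule_sub_sum:
  assumes X: "zigzag_linear K X" and W: "zigzag_submodule K X W" and U: "zigzag_submodule K X U"
  shows "zigzag_submodule K X (sub_sum X W U)"
  unfolding zigzag_submodule_def
proof (intro conjI ballI)
  fix i assume i: "i \<in> {lo X..hi X}"
  interpret vectorspace K "space X i" using X i by (auto simp: zigzag_linear_def)
  have "subspace K (submodule_sum (W i) (U i)) (space X i)"
    using W U i by (intro sum_is_subspace) (auto simp: zigzag_submodule_def)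
  moreover have "submodule_sum (W i) (U i) = sub_sum X W U i"
    by (auto simp: submodule_sum_def sub_sum_iff, blast)
  ultimately show "subspace K (sub_sum X W U i) (space X i)" by simp
next
  fix i assume i: "i \<in> {lo X..<hi X}"
  interpret A: linear_map K "space X (src X i)" "space X (tgt X i)" "arrow X i"
    using X i by (auto simp: zigzag_linear_def)
  have "W (src X i) \<subseteq> carrier (space X (src X i))" "U (src X i) \<subseteq> carrier (space X (src X i))"
    using W U src_tgt_range(1)[OF i, of X] by (simp_all add: zigzag_submodule_subset)
  moreover have "arrow X i ` W (src X i) \<subseteq> W (tgt X i)" "arrow X i ` U (src X i) \<subseteq> U (tgt X i)"
    using W U i by (auto simp: zigzag_submodule_def)
  ultimately show "arrow X i ` sub_sum X W U (src X i) \<subseteq> sub_sum X W U (tgt X i)"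
    by (fastforce simp: sub_sum_iff subset_iff)
qed

section \<open>Interval modules and their generators\<close>

text \<open>An interval module is described by one basis vector per index of its support, and zero
  elsewhere. The premise on arrows excludes exactly those entering \<open>{b..d}\<close> from
  outside, where a zero source cannot map to a nonzero target. On an arrow leaving
  \<open>{b..d}\<close> the equation says that the generator is killed.\<close>

definition interval_generator ::
    "('k, 'r) ring_scheme \<Rightarrow> ('k, 'v) zigzag \<Rightarrow> nat \<Rightarrow> nat \<Rightarrow> (nat \<Rightarrow> 'v) \<Rightarrow> bool" where
  "interval_generator K X b d e \<longleftrightarrow>
     (\<forall>i\<in>{lo X..hi X}. e i \<in> carrier (space X i) \<and>
        carrier (space X i) = (\<lambda>a. a \<odot>\<^bsub>space X i\<^esub> e i) ` carrier K \<and>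
        (e i = \<zero>\<^bsub>space X i\<^esub> \<longleftrightarrow> i \<notin> {b..d})) \<and>
     (\<forall>i\<in>{lo X..<hi X}. (tgt X i \<in> {b..d} \<longrightarrow> src X i \<in> {b..d}) \<longrightarrow>
        arrow X i (e (src X i)) = e (tgt X i))"

lemma interval_generatorD:
  assumes "interval_generator K X b d e"
  shows "i \<in> {lo X..hi X} \<Longrightarrow> e i \<in> carrier (space X i)"
    and "i \<in> {lo X..hi X} \<Longrightarrow> carrier (space X i) = (\<lambda>a. a \<odot>\<^bsub>space X i\<^esub> e i) ` carrier K"
    and "i \<in> {lo X..hi X} \<Longrightarrow> e i = \<zero>\<^bsub>space X i\<^esub> \<longleftrightarrow> i \<notin> {b..d}"
    and "i \<in> {lo X..<hi X} \<Longrightarrow> tgt X i \<in> {b..d} \<longrightarrow> src X i \<in> {b..d} \<Longrightarrow>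
      arrow X i (e (src X i)) = e (tgt X i)"
  using assms unfolding interval_generator_def by blast+

text \<open>All conditions are checked index by index, and the carriers \<open>S\<close> are
  overwritten by those of \<open>J\<close>, so the same vectors serve in the smaller range.\<close>

lemma interval_generator_restriction:
  assumes "interval_generator K (as_zigzag X J) b d e" "lo X \<le> p" "q \<le> hi X"
  shows "interval_generator K (as_zigzag (restriction (as_zigzag X S) p q) J) b d e"
  unfolding interval_generator_def
proof (intro conjI ballI impI, goal_cases)
  case (1 i)
  then show ?case using interval_generatorD(1)[OF assms(1), of i] assms(2,3) by simp
next
  case (2 i)
  then show ?case using interval_generatorD(2)[OF assms(1), of i] assms(2,3) by simp
next
  case (3 i)
  then show ?case using interval_generatorD(3)[OF assms(1), of i] assms(2,3) by simp
next
  case (4 i)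
  then show ?case using interval_generatorD(4)[OF assms(1), of i] assms(2,3) by simp
qed

lemma interval_module_simps [simp]:
  "lo (interval_module K l h \<tau> b d) = l" "hi (interval_module K l h \<tau> b d) = h"
  "dir (interval_module K l h \<tau> b d) = \<tau>"
  "space (interval_module K l h \<tau> b d) i =
     scalars_on K (if b \<le> i \<and> i \<le> d then carrier K else {\<zero>\<^bsub>K\<^esub>})"
  "arrow (interval_module K l h \<tau> b d) i v = (if b \<le> i \<and> Suc i \<le> d then v else \<zero>\<^bsub>K\<^esub>)"
  by (auto simp: interval_module_def)

lemma scalars_on_simps [simp]:
  "carrier (scalars_on K S) = S" "\<zero>\<^bsub>scalars_on K S\<^esub> = \<zero>\<^bsub>K\<^esub>"
  "a \<oplus>\<^bsub>scalars_on K S\<^esub> b = a \<oplus>\<^bsub>K\<^esub> b" "a \<odot>\<^bsub>scalars_on K S\<^esub> b = a \<otimes>\<^bsub>K\<^esub> b"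
  by (auto simp: scalars_on_def)

text \<open>Source and target of arrow \<open>i\<close> are \<open>i\<close> and
  \<open>Suc i\<close> in some order. This lets naturality be checked without splitting on the
  direction.\<close>

lemma src_tgt_interval_iff:
  "b \<le> i \<and> Suc i \<le> d \<longleftrightarrow> src X i \<in> {b..d} \<and> tgt X i \<in> {b..d}"
  by (auto simp: src_def tgt_def split: direction.splits)

text \<open>The generator is obtained by pulling back one on the support, and zero elsewhere, along
  the isomorphism. Its properties are verified after applying \<open>\<phi>\<close>, which is
  injective on each space.\<close>

lemma is_interval_imp_generator:
  assumes X: "zigzag_linear K X" and int: "is_interval K X b d"
  obtains e where "interval_generator K X b d e"
proof -
  let ?I = "interval_module K (lo X) (hi X) (dir X) b d"
  obtain \<phi> where
    lin: "\<And>i. i \<in> {lo X..hi X} \<Longrightarrow> linear_map K (space X i) (space ?I i) (\<phi> i)" and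
    bij: "\<And>i. i \<in> {lo X..hi X} \<Longrightarrow> bij_betw (\<phi> i) (carrier (space X i)) (carrier (space ?I i))" and
    nat: "\<And>i v. i \<in> {lo X..<hi X} \<Longrightarrow> v \<in> carrier (space X (src X i)) \<Longrightarrow>
            \<phi> (tgt X i) (arrow X i v) = arrow ?I i (\<phi> (src X i) v)"
    using int unfolding is_interval_def zigzag_iso_def by blast
  have le: "lo X \<le> b" "b \<le> d" "d \<le> hi X"
    using int by (auto simp: is_interval_def)
  then have "b \<in> {lo X..hi X}" by auto
  then interpret K: field K
    using X by (auto simp: zigzag_linear_def intro: vectorspace.axioms(2))
  define e where "e i = inv_into (carrier (space X i)) (\<phi> i) (if i \<in> {b..d} then \<one>\<^bsub>K\<^esub> else \<zero>\<^bsub>K\<^esub>)"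
    for i
  have e_car: "e i \<in> carrier (space X i)"
    and \<phi>_e: "\<phi> i (e i) = (if i \<in> {b..d} then \<one>\<^bsub>K\<^esub> else \<zero>\<^bsub>K\<^esub>)" if i: "i \<in> {lo X..hi X}" for i
  proof -
    have "(if i \<in> {b..d} then \<one>\<^bsub>K\<^esub> else \<zero>\<^bsub>K\<^esub>) \<in> \<phi> i ` carrier (space X i)"
      using bij[OF i] by (auto simp: bij_betw_def)
    then show "e i \<in> carrier (space X i)"
      and "\<phi> i (e i) = (if i \<in> {b..d} then \<one>\<^bsub>K\<^esub> else \<zero>\<^bsub>K\<^esub>)"
      unfolding e_def by (rule inv_into_into, rule f_inv_into_f)
  qed
  have inj: "u = v" if "i \<in> {lo X..hi X}" "u \<in> carrier (space X i)" "v \<in> carrier (space X i)"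
    "\<phi> i u = \<phi> i v" for i u v
    using bij[OF that(1)] that by (auto simp: bij_betw_def inj_on_def)
  have "interval_generator K X b d e"
    unfolding interval_generator_def
  proof (intro conjI ballI impI)
    fix i assume i: "i \<in> {lo X..hi X}"
    interpret P: linear_map K "space X i" "space ?I i" "\<phi> i" using lin[OF i] .
    show "e i \<in> carrier (space X i)" using e_car[OF i] .
    show "carrier (space X i) = (\<lambda>a. a \<odot>\<^bsub>space X i\<^esub> e i) ` carrier K"
    proof (intro equalityI subsetI)
      fix v assume v: "v \<in> carrier (space X i)"
      then have \<phi>v: "\<phi> i v \<in> carrier (space ?I i)" using bij[OF i] by (auto simp: bij_betw_def)
      then have \<phi>vK: "\<phi> i v \<in> carrier K" by (auto split: if_splits)
      \<comment> \<open>The coordinate of \<open>v\<close> is \<open>\<phi> i v\<close>: on the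
        support \<open>\<phi> i\<close> sends \<open>e i\<close> to one, and off the support both
        sides are zero.\<close>
      have "\<phi> i (\<phi> i v \<odot>\<^bsub>space X i\<^esub> e i) = \<phi> i v"
        using \<phi>v \<phi>vK e_car[OF i] \<phi>_e[OF i] P.T_smult[OF \<phi>vK e_car[OF i]] by (auto split: if_splits)
      then have "\<phi> i v \<odot>\<^bsub>space X i\<^esub> e i = v"
        using inj[OF i _ v] \<phi>vK e_car[OF i] by simp
      then show "v \<in> (\<lambda>a. a \<odot>\<^bsub>space X i\<^esub> e i) ` carrier K" using \<phi>vK by force
    next
      fix v assume "v \<in> (\<lambda>a. a \<odot>\<^bsub>space X i\<^esub> e i) ` carrier K"
      then show "v \<in> carrier (space X i)" using e_car[OF i] by auto
    qed
    have "e i = \<zero>\<^bsub>space X i\<^esub> \<longleftrightarrow> \<phi> i (e i) = \<zero>\<^bsub>K\<^esub>"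
      using inj[OF i e_car[OF i], of "\<zero>\<^bsub>space X i\<^esub>"] P.T0_is_0 by auto
    then show "e i = \<zero>\<^bsub>space X i\<^esub> \<longleftrightarrow> i \<notin> {b..d}" using \<phi>_e[OF i] by auto
  next
    fix i assume i: "i \<in> {lo X..<hi X}" and supp: "tgt X i \<in> {b..d} \<longrightarrow> src X i \<in> {b..d}"
    note r = src_tgt_range[OF i, of X]
    interpret A: linear_map K "space X (src X i)" "space X (tgt X i)" "arrow X i"
      using X i by (auto simp: zigzag_linear_def)
    \<comment> \<open>Both sides are one if both ends of the arrow lie in the support. Otherwise
      \<open>supp\<close> places the target outside the support, and both sides are zero.\<close>
    have "\<phi> (tgt X i) (arrow X i (e (src X i))) = \<phi> (tgt X i) (e (tgt X i))"
      using nat[OF i e_car[OF r(1)]] \<phi>_e[OF r(1)] \<phi>_e[OF r(2)] supp src_tgt_interval_iff[of b i d X]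
      by (auto split: if_splits)
    then show "arrow X i (e (src X i)) = e (tgt X i)"
      using inj[OF r(2)] e_car r by simp
  qed
  then show thesis by (rule that)
qed

text \<open>Taking coordinates with respect to the generator is the isomorphism, and
  \<open>a\<close> times \<open>e i\<close> is its inverse.\<close>

lemma generator_imp_is_interval:
  assumes X: "zigzag_linear K X" and e: "interval_generator K X b d e"
    and le: "lo X \<le> b" "b \<le> d" "d \<le> hi X"
  shows "is_interval K X b d"
proof -
  let ?I = "interval_module K (lo X) (hi X) (dir X) b d"
  have "b \<in> {lo X..hi X}" using le by auto
  then have fK: "field K"
    using X by (auto simp: zigzag_linear_def intro: vectorspace.axioms(2))
  then interpret K: field K .
  \<comment> \<open>Off the support \<open>e i\<close> is zero and determines no coordinate, so the
    value is fixed as the only element of the zero space.\<close>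
  define \<phi> where "\<phi> i v = (if i \<in> {b..d} then THE a. a \<in> carrier K \<and> v = a \<odot>\<^bsub>space X i\<^esub> e i else \<zero>\<^bsub>K\<^esub>)"
    for i v
  have car: "carrier (space X i) = (\<lambda>a. a \<odot>\<^bsub>space X i\<^esub> e i) ` carrier K"
    and e0: "e i = \<zero>\<^bsub>space X i\<^esub> \<longleftrightarrow> i \<notin> {b..d}"
    and e_car: "e i \<in> carrier (space X i)"
    and vs: "vectorspace K (space X i)" if "i \<in> {lo X..hi X}" for i
    using interval_generatorD(1-3)[OF e that] X that by (simp_all add: zigzag_linear_def)
  have \<phi>_smult: "\<phi> i (a \<odot>\<^bsub>space X i\<^esub> e i) = (if i \<in> {b..d} then a else \<zero>\<^bsub>K\<^esub>)"
    if "i \<in> {lo X..hi X}" "a \<in> carrier K" for i a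
    using that e0[OF that(1)] e_car[OF that(1)] vectorspace.smult_right_cancel[OF vs[OF that(1)]]
    by (auto simp: \<phi>_def intro!: the_equality)
  have lin: "linear_map K (space X i) (space ?I i) (\<phi> i)"
    and bij: "bij_betw (\<phi> i) (carrier (space X i)) (carrier (space ?I i))"
    if i: "i \<in> {lo X..hi X}" for i
  proof -
    interpret vectorspace K "space X i" using vs[OF i] .
    note e = e_car[OF i]
    have vsI: "vectorspace K (space ?I i)"
      using fK by (simp add: vectorspace_scalars_on)
    have "a \<odot>\<^bsub>space X i\<^esub> e i \<oplus>\<^bsub>space X i\<^esub> b \<odot>\<^bsub>space X i\<^esub> e i = (a \<oplus>\<^bsub>K\<^esub> b) \<odot>\<^bsub>space X i\<^esub> e i"
      "a \<odot>\<^bsub>space X i\<^esub> (b \<odot>\<^bsub>space X i\<^esub> e i) = (a \<otimes>\<^bsub>K\<^esub> b) \<odot>\<^bsub>space X i\<^esub> e i"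
      if "a \<in> carrier K" "b \<in> carrier K" for a b
      using that e by (simp_all add: smult_l_distr smult_assoc1)
    then have "\<phi> i \<in> module_hom K (space X i) (space ?I i)"
      by (auto simp: module_hom_def car[OF i] \<phi>_smult[OF i])
    then show "linear_map K (space X i) (space ?I i) (\<phi> i)"
      using vsI by (simp add: linear_map_def mod_hom_def mod_hom_axioms_def vectorspace.axioms(1)
          vectorspace_axioms module_axioms)
    show "bij_betw (\<phi> i) (carrier (space X i)) (carrier (space ?I i))"
    proof (rule bij_betw_byWitness[where f' = "\<lambda>a. a \<odot>\<^bsub>space X i\<^esub> e i"])
      show "\<forall>v\<in>carrier (space X i). \<phi> i v \<odot>\<^bsub>space X i\<^esub> e i = v"
        using e0[OF i] by (auto simp: car[OF i] \<phi>_smult[OF i])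
      show "\<forall>a\<in>carrier (space ?I i). \<phi> i (a \<odot>\<^bsub>space X i\<^esub> e i) = a"
        by (auto simp: \<phi>_smult[OF i])
      show "\<phi> i ` carrier (space X i) \<subseteq> carrier (space ?I i)"
        by (auto simp: car[OF i] \<phi>_smult[OF i])
      show "(\<lambda>a. a \<odot>\<^bsub>space X i\<^esub> e i) ` carrier (space ?I i) \<subseteq> carrier (space X i)"
        using e by auto
    qed
  qed
  have "\<phi> (tgt X i) (arrow X i v) = arrow ?I i (\<phi> (src X i) v)"
    if i: "i \<in> {lo X..<hi X}" and v: "v \<in> carrier (space X (src X i))" for i v
  proof -
    note r = src_tgt_range[OF i, of X]
    interpret A: linear_map K "space X (src X i)" "space X (tgt X i)" "arrow X i"
      using X i by (auto simp: zigzag_linear_def)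
    obtain a where a: "a \<in> carrier K" "v = a \<odot>\<^bsub>space X (src X i)\<^esub> e (src X i)"
      using v car[OF r(1)] by auto
    have arrow_I: "arrow ?I i u = (if src X i \<in> {b..d} \<and> tgt X i \<in> {b..d} then u else \<zero>\<^bsub>K\<^esub>)" for u
      by (simp only: interval_module_simps src_tgt_interval_iff[of b i d X])
    show ?thesis
    proof (cases "tgt X i \<in> {b..d} \<longrightarrow> src X i \<in> {b..d}")
      case True
      have "arrow X i v = a \<odot>\<^bsub>space X (tgt X i)\<^esub> e (tgt X i)"
        using interval_generatorD(4)[OF e i True] a e_car[OF r(1)] by simp
      then show ?thesis
        unfolding arrow_I a(2) using True \<phi>_smult[OF r(1) a(1)] \<phi>_smult[OF r(2) a(1)] by auto
    next
      \<comment> \<open>The arrow enters the support from outside, so \<open>v\<close> is a multiple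
        of a zero generator. Its image is written as a zero multiple of the target generator to make
        \<open>\<phi>_smult\<close> applicable.\<close>
      case False
      then have "arrow X i v = \<zero>\<^bsub>K\<^esub> \<odot>\<^bsub>space X (tgt X i)\<^esub> e (tgt X i)"
        using a e0[OF r(1)] e_car[OF r(2)] by simp
      then show ?thesis
        unfolding arrow_I using False \<phi>_smult[OF r(2), of "\<zero>\<^bsub>K\<^esub>"] by auto
    qed
  qed
  with lin bij have "zigzag_iso K X ?I"
    unfolding zigzag_iso_def by (intro conjI exI[of _ \<phi>]) auto
  with le show ?thesis by (simp add: is_interval_def)
qed

section \<open>Intervals spanning a sum of two submodules\<close>

text \<open>The range of \<open>X\<close> may exceed \<open>{b..d}\<close>, so that the result
  covers both the whole sum \<open>J1 + J2\<close> and its restriction. The two vanishing conditions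
  supply the start and the contradiction of an induction from \<open>b\<close> to
  \<open>d\<close>.\<close>

lemma interval_not_direct_summand:
  assumes X: "zigzag_linear K X"
    and J1: "zigzag_submodule K X J1" and J2: "zigzag_submodule K X J2"
    and J12: "\<And>i. i \<in> {lo X..hi X} \<Longrightarrow> J1 i \<inter> J2 i = {\<zero>\<^bsub>space X i\<^esub>}"
    and sum: "\<And>i. i \<in> {lo X..hi X} \<Longrightarrow> sub_sum X J1 J2 i = carrier (space X i)"
    and J2b: "J2 b = {\<zero>\<^bsub>space X b\<^esub>}" and J1d: "J1 d = {\<zero>\<^bsub>space X d\<^esub>}"
    and int: "is_interval K (as_zigzag X W) b d"
  shows "\<not> direct_summand K X W"
proof
  assume "direct_summand K X W"
  then obtain U where W: "zigzag_submodule K X W" and U: "zigzag_submodule K X U"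
    and WU: "\<And>i. i \<in> {lo X..hi X} \<Longrightarrow> W i \<inter> U i = {\<zero>\<^bsub>space X i\<^esub>}"
    and WU_sum: "\<And>i. i \<in> {lo X..hi X} \<Longrightarrow> sub_sum X W U i = carrier (space X i)"
    unfolding direct_summand_def by blast
  have le: "lo X \<le> b" "b \<le> d" "d \<le> hi X"
    using int by (auto simp: is_interval_def)
  obtain w where "interval_generator K (as_zigzag X W) b d w"
    using is_interval_imp_generator[OF zigzag_linear_as_zigzag[OF X W] int] .
  note gen = this
  have w: "w i \<in> W i" and W_eq: "W i = (\<lambda>a. a \<odot>\<^bsub>space X i\<^esub> w i) ` carrier K"
    and w_nz: "w i \<noteq> \<zero>\<^bsub>space X i\<^esub>" if "i \<in> {b..d}" for i
    using interval_generatorD(1-3)[OF gen, of i] that le by auto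
  have w_arrow: "arrow X i (w (src X i)) = w (tgt X i)" if "i \<in> {b..<d}" for i
    using interval_generatorD(4)[OF gen, of i] that le src_tgt_range[of i b d X] by simp
  have sub: "subspace K (J1 i) (space X i)" "subspace K (J2 i) (space X i)"
    "subspace K (W i) (space X i)" "subspace K (U i) (space X i)" if "i \<in> {b..d}" for i
    using that le J1 J2 W U by (auto simp: zigzag_submodule_def)
  have "\<exists>x y. x \<in> J1 i \<and> y \<in> J2 i \<and> w i = x \<oplus>\<^bsub>space X i\<^esub> y" if i: "i \<in> {b..d}" for i
  proof -
    have "w i \<in> sub_sum X J1 J2 i"
      using w[OF i] subspaceD(2)[OF sub(3)[OF i]] sum i le by auto
    then show ?thesis by (auto simp: sub_sum_iff)
  qed
  then obtain x y where x: "\<And>i. i \<in> {b..d} \<Longrightarrow> x i \<in> J1 i" and y: "\<And>i. i \<in> {b..d} \<Longrightarrow> y i \<in> J2 i"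
    and w_eq: "\<And>i. i \<in> {b..d} \<Longrightarrow> w i = x i \<oplus>\<^bsub>space X i\<^esub> y i"
    by metis
  have lin: "linear_map K (space X (src X i)) (space X (tgt X i)) (arrow X i)"
    and preserved: "arrow X i ` J1 (src X i) \<subseteq> J1 (tgt X i)" "arrow X i ` J2 (src X i) \<subseteq> J2 (tgt X i)"
      "arrow X i ` W (src X i) \<subseteq> W (tgt X i)" "arrow X i ` U (src X i) \<subseteq> U (tgt X i)"
    if "i \<in> {b..<d}" for i
    using that le X J1 J2 W U by (auto simp: zigzag_linear_def zigzag_submodule_def)
  \<comment> \<open>The arrow preserves \<open>J1\<close> and \<open>J2\<close>, so applying it to
    \<open>w = x + y\<close> and comparing the components in \<open>J2\<close> gives the
    claim.\<close>
  have y_arrow: "arrow X i (y (src X i)) = y (tgt X i)" if i: "i \<in> {b..<d}" for i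
  proof -
    note r = src_tgt_range[OF i, of X]
    interpret A: linear_map K "space X (src X i)" "space X (tgt X i)" "arrow X i" using lin[OF i] .
    have mem: "arrow X i (x (src X i)) \<in> J1 (tgt X i)" "arrow X i (y (src X i)) \<in> J2 (tgt X i)"
      using preserved(1,2)[OF i] x[OF r(1)] y[OF r(1)] by auto
    have eq: "arrow X i (x (src X i)) \<oplus>\<^bsub>space X (tgt X i)\<^esub> arrow X i (y (src X i)) =
        x (tgt X i) \<oplus>\<^bsub>space X (tgt X i)\<^esub> y (tgt X i)"
      using w_arrow[OF i] w_eq[OF r(1)] w_eq[OF r(2)] x[OF r(1)] y[OF r(1)]
        subspaceD(2)[OF sub(1)[OF r(1)]] subspaceD(2)[OF sub(2)[OF r(1)]] by (auto simp: subset_iff)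
    have "tgt X i \<in> {lo X..hi X}" using r(2) le by auto
    then show ?thesis
      using sum_components_unique(2)[OF sub(1)[OF r(2)] sub(2)[OF r(2)] J12 mem(1) x[OF r(2)] mem(2) y[OF r(2)] eq]
      by simp
  qed
  have "y i \<in> U i" if "b \<le> i" "i \<le> d" for i
    using that
  proof (induction i rule: dec_induct)
    case base
    have "b \<in> {b..d}" using le by simp
    then show ?case using J2b y[of b] subspaceD(3)[OF sub(4)[of b]] by auto
  next
    case (step i)
    then have i: "i \<in> {b..<d}" and IH: "y i \<in> U i" by auto
    show ?case
    proof (cases "dir X i")
      case Forward
      then have st: "src X i = i" "tgt X i = Suc i" by (auto simp: src_def tgt_def)
      show ?thesis using y_arrow[OF i] preserved(4)[OF i] IH by (auto simp: st)
    next
      \<comment> \<open>Here membership in \<open>U\<close> must be pulled back from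
        \<open>i\<close> to \<open>Suc i\<close>. Split \<open>y (Suc i)\<close> as
        \<open>v + u\<close> along \<open>W\<close> and \<open>U\<close>. Its image
        \<open>y i\<close> lies in \<open>U\<close>, so the image of \<open>v\<close> vanishes, and
        injectivity of the arrow on \<open>W\<close> gives \<open>v = 0\<close>.\<close>
      case Backward
      then have st: "src X i = Suc i" "tgt X i = i" by (auto simp: src_def tgt_def)
      have r: "Suc i \<in> {b..d}" "i \<in> {b..d}" using i by auto
      interpret A: linear_map K "space X (Suc i)" "space X i" "arrow X i"
        using lin[OF i] by (simp add: st)
      have "y (Suc i) \<in> sub_sum X W U (Suc i)"
        using y[OF r(1)] subspaceD(2)[OF sub(2)[OF r(1)]] WU_sum[of "Suc i"] r(1) le by auto
      then obtain v u where v: "v \<in> W (Suc i)" and u: "u \<in> U (Suc i)"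
        and yvu: "y (Suc i) = v \<oplus>\<^bsub>space X (Suc i)\<^esub> u"
        by (auto simp: sub_sum_iff)
      have car: "v \<in> carrier (space X (Suc i))" "u \<in> carrier (space X (Suc i))" "y i \<in> carrier (space X i)"
        using v u y[OF r(2)] subspaceD(2)[OF sub(3)[OF r(1)]] subspaceD(2)[OF sub(4)[OF r(1)]]
          subspaceD(2)[OF sub(2)[OF r(2)]] by auto
      \<comment> \<open>The explicit zero is the component of \<open>y i\<close> in
        \<open>W\<close>.\<close>
      have eq: "arrow X i v \<oplus>\<^bsub>space X i\<^esub> arrow X i u = \<zero>\<^bsub>space X i\<^esub> \<oplus>\<^bsub>space X i\<^esub> y i"
        using y_arrow[OF i] car by (simp add: st yvu)
      have mem: "arrow X i v \<in> W i" "arrow X i u \<in> U i"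
        using preserved(3,4)[OF i] v u by (auto simp: st)
      have "i \<in> {lo X..hi X}" using r(2) le by auto
      then have av: "arrow X i v = \<zero>\<^bsub>space X i\<^esub>"
        using sum_components_unique(1)[OF sub(3)[OF r(2)] sub(4)[OF r(2)] WU mem(1)
          subspaceD(3)[OF sub(3)[OF r(2)]] mem(2) IH eq] by simp
      obtain a where a: "a \<in> carrier K" "v = a \<odot>\<^bsub>space X (Suc i)\<^esub> w (Suc i)"
        using v W_eq[OF r(1)] by auto
      have wc: "w (Suc i) \<in> carrier (space X (Suc i))" "w i \<in> carrier (space X i)"
        using w r subspaceD(2)[OF sub(3)] by blast+
      \<comment> \<open>The arrow sends \<open>w (Suc i)\<close> to the nonzero vector
        \<open>w i\<close>, so a multiple is killed only if its coefficient is zero.\<close>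
      have "a \<odot>\<^bsub>space X i\<^esub> w i = \<zero>\<^bsub>K\<^esub> \<odot>\<^bsub>space X i\<^esub> w i"
        using av a wc w_arrow[OF i] by (simp add: st)
      then have "a = \<zero>\<^bsub>K\<^esub>"
        using A.W.smult_right_cancel[OF a(1) _ wc(2) w_nz[OF r(2)]] by simp
      then show ?thesis using yvu a wc u car by simp
    qed
  qed
  then have "y d \<in> U d" using le by simp
  moreover have d: "d \<in> {b..d}" using le by simp
  \<comment> \<open>The component \<open>x d\<close> lies in \<open>J1 d\<close>, which is
    zero.\<close>
  have "y d = w d"
  proof -
    interpret vectorspace K "space X d" using subspace.vs[OF sub(1)[OF d]] .
    show ?thesis
      using w_eq[OF d] x[OF d] J1d y[OF d] subspaceD(2)[OF sub(2)[OF d]] by auto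
  qed
  ultimately have "w d \<in> W d \<inter> U d" using w[OF d] by simp
  then show False using WU[of d] w_nz[OF d] d le by auto
qed

text \<open>The range is exactly \<open>{b1..d2}\<close>, which the two supports cover because
  \<open>b2 \<le> d1\<close>. Hence the diagonal vectors vanish nowhere and generate a module with
  full support.\<close>

lemma breaker_diagonal:
  assumes X: "zigzag_linear K X" and range: "lo X = b1" "hi X = d2"
    and J1: "zigzag_submodule K X J1" and J2: "zigzag_submodule K X J2"
    and J12: "\<And>i. i \<in> {lo X..hi X} \<Longrightarrow> J1 i \<inter> J2 i = {\<zero>\<^bsub>space X i\<^esub>}"
    and e: "interval_generator K (as_zigzag X J1) b1 d1 e"
    and f: "interval_generator K (as_zigzag X J2) b2 d2 f"
    and ord: "b1 < b2" "b2 \<le> d1" "d1 < d2"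
    and dir: "dir X (b2 - 1) = Backward" "dir X d1 = Forward"
  obtains W where "zigzag_submodule K X W" "is_interval K (as_zigzag X W) b1 d2"
proof -
  define g where "g i = e i \<oplus>\<^bsub>space X i\<^esub> f i" for i
  define W where "W i = (\<lambda>a. a \<odot>\<^bsub>space X i\<^esub> g i) ` carrier K" for i
  have e1: "e i \<in> J1 i" "e i = \<zero>\<^bsub>space X i\<^esub> \<longleftrightarrow> i \<notin> {b1..d1}"
    and f1: "f i \<in> J2 i" "f i = \<zero>\<^bsub>space X i\<^esub> \<longleftrightarrow> i \<notin> {b2..d2}"
    and sub: "subspace K (J1 i) (space X i)" "subspace K (J2 i) (space X i)"
    and vs: "vectorspace K (space X i)"
    if "i \<in> {b1..d2}" for i
    using interval_generatorD(1,3)[OF e, of i] interval_generatorD(1,3)[OF f, of i] that J1 J2 X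
    by (simp_all add: range zigzag_submodule_def zigzag_linear_def)
  have car: "e i \<in> carrier (space X i)" "f i \<in> carrier (space X i)" if "i \<in> {b1..d2}" for i
    using e1(1)[OF that] f1(1)[OF that] sub[OF that] by (auto dest: subspaceD(2))
  have g_car: "g i \<in> carrier (space X i)" if i: "i \<in> {b1..d2}" for i
  proof -
    interpret vectorspace K "space X i" using vs[OF i] .
    show ?thesis using car[OF i] by (simp add: g_def)
  qed
  \<comment> \<open>Independence of \<open>J1\<close> and \<open>J2\<close> turns a zero sum into
    two zero generators, but every index lies in at least one support.\<close>
  have g_nz: "g i \<noteq> \<zero>\<^bsub>space X i\<^esub>" if i: "i \<in> {b1..d2}" for i
  proof
    interpret vectorspace K "space X i" using vs[OF i] .
    assume "g i = \<zero>\<^bsub>space X i\<^esub>"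
    then have "e i \<oplus>\<^bsub>space X i\<^esub> f i = \<zero>\<^bsub>space X i\<^esub> \<oplus>\<^bsub>space X i\<^esub> \<zero>\<^bsub>space X i\<^esub>"
      by (simp add: g_def)
    then have "e i = \<zero>\<^bsub>space X i\<^esub>" "f i = \<zero>\<^bsub>space X i\<^esub>"
      using sum_components_unique[OF sub[OF i] J12] e1(1)[OF i] f1(1)[OF i]
        subspaceD(3)[OF sub(1)[OF i]] subspaceD(3)[OF sub(2)[OF i]] i by (auto simp: range)
    then show False using i ord e1(2)[OF i] f1(2)[OF i] by auto
  qed
  have g_arrow: "arrow X i (g (src X i)) = g (tgt X i)" if i: "i \<in> {b1..<d2}" for i
  proof -
    note r = src_tgt_range[OF i, of X]
    interpret A: linear_map K "space X (src X i)" "space X (tgt X i)" "arrow X i"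
      using X i by (auto simp: zigzag_linear_def range)
    \<comment> \<open>Within the range only arrow \<open>d1\<close> crosses the boundary of
      \<open>{b1..d1}\<close>, and being forward it leaves the interval.\<close>
    have "tgt X i \<in> {b1..d1} \<longrightarrow> src X i \<in> {b1..d1}"
      using i dir(2) by (cases "i = d1") (auto simp: src_def tgt_def split: direction.splits)
    then have "arrow X i (e (src X i)) = e (tgt X i)"
      using interval_generatorD(4)[OF e, of i] i by (simp add: range)
    \<comment> \<open>Only arrow \<open>b2 - 1\<close> crosses the boundary of
      \<open>{b2..d2}\<close>, and being backward it leaves the interval. Since
      \<open>b1 < b2\<close>, the truncated subtraction yields the true predecessor.\<close>
    moreover have "tgt X i \<in> {b2..d2} \<longrightarrow> src X i \<in> {b2..d2}"
      using i dir(1) ord by (cases "i = b2 - 1") (auto simp: src_def tgt_def split: direction.splits)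
    then have "arrow X i (f (src X i)) = f (tgt X i)"
      using interval_generatorD(4)[OF f, of i] i by (simp add: range)
    ultimately show ?thesis using car[OF r(1)] by (simp add: g_def)
  qed
  have W: "zigzag_submodule K X W"
    unfolding zigzag_submodule_def range
  proof (intro conjI ballI)
    fix i assume i: "i \<in> {b1..d2}"
    interpret vectorspace K "space X i" using vs[OF i] .
    note gi = g_car[OF i]
    have "\<zero>\<^bsub>space X i\<^esub> = \<zero>\<^bsub>K\<^esub> \<odot>\<^bsub>space X i\<^esub> g i" using gi by simp
    then have "\<zero>\<^bsub>space X i\<^esub> \<in> W i" unfolding W_def by blast
    moreover have "a \<odot>\<^bsub>space X i\<^esub> g i \<oplus>\<^bsub>space X i\<^esub> b \<odot>\<^bsub>space X i\<^esub> g i = (a \<oplus>\<^bsub>K\<^esub> b) \<odot>\<^bsub>space X i\<^esub> g i"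
      "a \<odot>\<^bsub>space X i\<^esub> (b \<odot>\<^bsub>space X i\<^esub> g i) = (a \<otimes>\<^bsub>K\<^esub> b) \<odot>\<^bsub>space X i\<^esub> g i"
      if "a \<in> carrier K" "b \<in> carrier K" for a b
      using that gi by (simp_all add: smult_l_distr smult_assoc1)
    ultimately show "subspace K (W i) (space X i)"
      using gi by (intro subspace.intro submodule.intro vectorspace_axioms module_axioms)
        (auto simp: W_def)
  next
    fix i assume i: "i \<in> {b1..<d2}"
    interpret A: linear_map K "space X (src X i)" "space X (tgt X i)" "arrow X i"
      using X i by (auto simp: zigzag_linear_def range)
    show "arrow X i ` W (src X i) \<subseteq> W (tgt X i)"
      using g_arrow[OF i] g_car[OF src_tgt_range(1)[OF i, of X]] by (auto simp: W_def)
  qed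
  have "g i \<in> W i" if i: "i \<in> {b1..d2}" for i
  proof -
    interpret vectorspace K "space X i" using vs[OF i] .
    have "g i = \<one>\<^bsub>K\<^esub> \<odot>\<^bsub>space X i\<^esub> g i" using g_car[OF i] by simp
    then show ?thesis unfolding W_def by blast
  qed
  moreover have "W i = (\<lambda>a. a \<odot>\<^bsub>space X i\<^esub> g i) ` carrier K" for i
    by (rule W_def)
  ultimately have "interval_generator K (as_zigzag X W) b1 d2 g"
    unfolding interval_generator_def using g_nz g_arrow by (simp add: range)
  then have "is_interval K (as_zigzag X W) b1 d2"
    using zigzag_linear_as_zigzag[OF X W] ord by (intro generator_imp_is_interval) (auto simp: range)
  with W show thesis by (rule that)
qed

text \<open>A common vector \<open>v\<close> can be placed in the slot of \<open>A\<close> or in the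
  slot of \<open>B\<close>, with zeros elsewhere. Both choices sum to \<open>v\<close>, so
  uniqueness of decompositions forces \<open>v\<close> to be zero.\<close>

lemma interval_decomposition_inter:
  assumes X: "zigzag_linear K X" and Js: "interval_decomposition K X Js"
    and A: "A \<in> set Js" and B: "B \<in> set Js" and "A \<noteq> B" and i: "i \<in> {lo X..hi X}"
  shows "A i \<inter> B i = {\<zero>\<^bsub>space X i\<^esub>}"
proof -
  interpret vectorspace K "space X i" using X i by (auto simp: zigzag_linear_def)
  obtain k l where k: "k < length Js" "A = Js ! k" and l: "l < length Js" "B = Js ! l"
    using A B by (auto simp: in_set_conv_nth)
  then have "k \<noteq> l" using \<open>A \<noteq> B\<close> by auto
  have sub: "subspace K (J i) (space X i)" if "J \<in> set Js" for J
    using Js that i by (auto simp: interval_decomposition_def zigzag_submodule_def)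
  have "v = \<zero>\<^bsub>space X i\<^esub>" if v: "v \<in> A i" "v \<in> B i" for v
  proof -
    have vc: "v \<in> carrier (space X i)" using v subspaceD(2)[OF sub[OF A]] by auto
    \<comment> \<open>The vector \<open>v\<close> sits in slot \<open>m\<close>. The function is
      restricted to the index set because uniqueness is asserted among extensional
      functions.\<close>
    define \<delta> where "\<delta> m = (\<lambda>j\<in>{..<length Js}. if m = j then v else \<zero>\<^bsub>space X i\<^esub>)" for m
    have mem: "\<delta> m \<in> (\<Pi>\<^sub>E j\<in>{..<length Js}. (Js ! j) i)" if "v \<in> (Js ! m) i" for m
      using that subspaceD(3)[OF sub] by (auto simp: \<delta>_def)
    have total: "(\<Oplus>\<^bsub>space X i\<^esub>j\<in>{..<length Js}. \<delta> m j) = v" if "m < length Js" for m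
    proof -
      have "(\<Oplus>\<^bsub>space X i\<^esub>j\<in>{..<length Js}. \<delta> m j) =
          (\<Oplus>\<^bsub>space X i\<^esub>j\<in>{..<length Js}. if m = j then v else \<zero>\<^bsub>space X i\<^esub>)"
        using vc by (intro M.finsum_cong') (auto simp: \<delta>_def)
      also have "\<dots> = v"
        using M.finsum_singleton[of m "{..<length Js}" "\<lambda>_. v"] vc that by auto
      finally show ?thesis .
    qed
    have "\<exists>!x. x \<in> (\<Pi>\<^sub>E j\<in>{..<length Js}. (Js ! j) i) \<and> (\<Oplus>\<^bsub>space X i\<^esub>j\<in>{..<length Js}. x j) = v"
      using Js i vc by (auto simp: interval_decomposition_def)
    then have "\<delta> k = \<delta> l"
      using mem[of k] mem[of l] total k l v by blast
    then have "\<delta> k k = \<delta> l k" by simp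
    then show ?thesis using k \<open>k \<noteq> l\<close> by (simp add: \<delta>_def)
  qed
  then show ?thesis using subspaceD(3)[OF sub[OF A]] subspaceD(3)[OF sub[OF B]] by blast
qed

section \<open>Nonsplitting diagonal and absence of a splitting copy for a breaker pair\<close>

theorem corollary3p16:
  fixes K :: "('k, 'r) ring_scheme"
    and V :: "('k, 'v) zigzag"
    and n p q b1 d1 b2 d2 :: nat
    and Js :: "(nat \<Rightarrow> 'v set) list"
    and J1 J2 :: "nat \<Rightarrow> 'v set"
  defines "X \<equiv> restriction V p q"
  defines "S \<equiv> as_zigzag X (sub_sum X J1 J2)"
  assumes "field K"
    and "zigzag_module K V" and "lo V = 1" and "hi V = n"
    and "1 \<le> p" and "p \<le> q" and "q \<le> n"
    and "interval_decomposition K X Js"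
    and "J1 \<in> set Js" and "J2 \<in> set Js"
    and "breaker_pair K X J1 J2 b1 d1 b2 d2"
  shows "(\<exists>W. nonsplitting K (restriction S b1 d2) W \<and>
              is_interval K (as_zigzag (restriction S b1 d2) W) b1 d2) \<and>
         \<not> (\<exists>W. direct_summand K S W \<and> is_interval K (as_zigzag S W) b1 d2)"
proof -
  note Js = assms(10) and mem = assms(11,12)
  have int: "is_interval K (as_zigzag X J1) b1 d1" "is_interval K (as_zigzag X J2) b2 d2"
    and ord: "b1 < b2" "b2 \<le> d1" "d1 < d2"
    and dir: "dir X (b2 - 1) = Backward" "dir X d1 = Forward"
    using assms(13) by (auto simp: breaker_pair_def)
  have "zigzag_linear K V"
    using assms(4) by (auto simp: zigzag_linear_def zigzag_module_def)
  then have X: "zigzag_linear K X"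
    unfolding X_def using assms(5-9) by (intro zigzag_linear_restriction) auto
  have J: "zigzag_submodule K X J1" "zigzag_submodule K X J2"
    using Js mem by (auto simp: interval_decomposition_def)
  obtain e where e: "interval_generator K (as_zigzag X J1) b1 d1 e"
    using is_interval_imp_generator[OF zigzag_linear_as_zigzag[OF X J(1)] int(1)] .
  obtain f where f: "interval_generator K (as_zigzag X J2) b2 d2 f"
    using is_interval_imp_generator[OF zigzag_linear_as_zigzag[OF X J(2)] int(2)] .
  have range: "lo X \<le> b1" "d2 \<le> hi X"
    using int by (auto simp: is_interval_def)
  \<comment> \<open>The index \<open>d2\<close> lies beyond the support of \<open>J1\<close>, and
    \<open>b1\<close> lies before that of \<open>J2\<close>. These facts provide the vanishing at
    the two ends of \<open>{b1..d2}\<close>.\<close>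
  have J1d: "J1 d2 = {\<zero>\<^bsub>space X d2\<^esub>}"
  proof -
    interpret vectorspace K "space X d2" using X range ord by (auto simp: zigzag_linear_def)
    have "J1 d2 = (\<lambda>a. a \<odot>\<^bsub>space X d2\<^esub> e d2) ` carrier K" "e d2 = \<zero>\<^bsub>space X d2\<^esub>"
      using interval_generatorD(2,3)[OF e, of d2] range ord by simp_all
    then show ?thesis by auto
  qed
  have J2b: "J2 b1 = {\<zero>\<^bsub>space X b1\<^esub>}"
  proof -
    interpret vectorspace K "space X b1" using X range ord by (auto simp: zigzag_linear_def)
    have "J2 b1 = (\<lambda>a. a \<odot>\<^bsub>space X b1\<^esub> f b1) ` carrier K" "f b1 = \<zero>\<^bsub>space X b1\<^esub>"
      using interval_generatorD(2,3)[OF f, of b1] range ord by simp_all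
    then show ?thesis by auto
  qed
  \<comment> \<open>At \<open>b1\<close> the family \<open>J2\<close> is zero while
    \<open>J1\<close> has a nonzero generator. Distinctness is what gives the two families different
    slots in \<open>Js\<close>.\<close>
  have "J1 \<noteq> J2"
  proof
    assume "J1 = J2"
    then have "e b1 = \<zero>\<^bsub>space X b1\<^esub>"
      using J2b interval_generatorD(1)[OF e, of b1] range ord by simp
    then show False
      using interval_generatorD(3)[OF e, of b1] range ord by simp
  qed
  then have J12: "J1 i \<inter> J2 i = {\<zero>\<^bsub>space X i\<^esub>}" if "i \<in> {lo X..hi X}" for i
    using interval_decomposition_inter[OF X Js mem] that by simp
  have sum: "zigzag_submodule K X (sub_sum X J1 J2)"
    using zigzag_submodule_sub_sum[OF X J] .
  have S: "zigzag_linear K S"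
    unfolding S_def by (rule zigzag_linear_as_zigzag[OF X sum])
  have JS: "zigzag_submodule K S J1" "zigzag_submodule K S J2"
    unfolding S_def
     apply (rule zigzag_submodule_as_zigzag[OF J(1) sum subset_sub_sum(1)[OF J]], assumption)
    apply (rule zigzag_submodule_as_zigzag[OF J(2) sum subset_sub_sum(2)[OF J]], assumption)
    done
  let ?R = "restriction S b1 d2"
  have R: "zigzag_linear K ?R"
    using S range by (intro zigzag_linear_restriction) (auto simp: S_def)
  have JR: "zigzag_submodule K ?R J1" "zigzag_submodule K ?R J2"
    using JS range by (auto intro!: zigzag_submodule_restriction simp: S_def)
  have eR: "interval_generator K (as_zigzag ?R J1) b1 d1 e"
    and fR: "interval_generator K (as_zigzag ?R J2) b2 d2 f"
    unfolding S_def using e f range by (auto intro!: interval_generator_restriction)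
  obtain W where W: "zigzag_submodule K ?R W" "is_interval K (as_zigzag ?R W) b1 d2"
    using breaker_diagonal[OF R _ _ JR _ eR fR ord] J12 dir range by (auto simp: S_def)
  have "\<not> direct_summand K ?R W"
    using interval_not_direct_summand[OF R JR _ _ _ _ W(2)] J12 J1d J2b range by (auto simp: S_def)
  with W have "nonsplitting K ?R W" by (simp add: nonsplitting_def)
  \<comment> \<open>The same obstruction is now applied over the full index range of
    \<open>S\<close>, whose carriers are the sums of \<open>J1\<close> and \<open>J2\<close> by
    construction.\<close>
  moreover have "\<not> direct_summand K S U" if "is_interval K (as_zigzag S U) b1 d2" for U
    using interval_not_direct_summand[OF S JS _ _ _ _ that] J12 J1d J2b by (auto simp: S_def)
  ultimately show ?thesis using W(2) by blast
qed

end
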